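(* Let $\lambda\ge 1$, $\mu\ge 0$, let $\varphi$ be as in the context with $\varphi(z)=1+B_1z+B_2z^2+\cdots$, and let $f(z)=z+\sum_{n\ge2}a_nz^n$ belong to $\mathcal N^{\mu,\lambda}_\Sigma(\varphi)$. Put $$D:=(2\lambda+\mu)(1+\mu)B_1^2+2(B_1-B_2)(\lambda+\mu)^2,$$ and assume $D\neq 0$. Then for every $\delta\in\mathbb R$, $$|a_3-\delta a_2^2|\le\begin{cases}\dfrac{B_1}{2\lambda+\mu}, & \text{if } |\delta-1|\le \dfrac{\mu+1}{2}\left|1+\dfrac{2(B_1-B_2)(\lambda+\mu)^2}{B_1^2(2\lambda+\mu)(1+\mu)}\right|,\\[3mm] \dfrac{2B_1^3|\delta-1|}{|D|}, & \text{if } |\delta-1|\ge \dfrac{\mu+1}{2}\left|1+\dfrac{2(B_1-B_2)(\lambda+\mu)^2}{B_1^2(2\lambda+\mu)(1+\mu)}\right|.\end{cases}$$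
   Context: Let $\mathbb U=\{z\in\mathbb C:|z|<1\}$ and let $\mathcal A$ be the class of functions $f(z)=z+\sum_{n\ge2}a_nz^n$ analytic in $\mathbb U$. $\Sigma$ denotes the class of bi-univalent functions: $f\in\mathcal A$ univalent in $\mathbb U$ such that the inverse $f^{-1}$ (defined near $0$) extends to an analytic univalent function on $\mathbb U$; this extension is denoted $g=f^{-1}$, and $g(w)=w-a_2w^2+(2a_2^2-a_3)w^3+\cdots$. For $F,G$ analytic in $\mathbb U$, $F\prec G$ (subordination) means there is an analytic $w:\mathbb U\to\mathbb U$ with $w(0)=0$ and $F=G\circ w$. Throughout, $\varphi$ is analytic and univalent in $\mathbb U$ with $\Re\varphi(z)>0$, $\varphi(0)=1$, $\varphi'(0)>0$, $\varphi(\mathbb U)$ starlike with respect to $1$ and symmetric with respect to the real axis, and $\varphi(z)=1+B_1z+B_2z^2+B_3z^3+\cdots$ with all $B_j$ real and $B_1>0$. For $\lambda\ge1$ and $\mu\ge0$, $\mathcal N^{\mu,\lambda}_\Sigma(\varphi)$ is the set of $f\in\Sigma$ such that $$(1-\lambda)\Big(\frac{f(z)}{z}\Big)^{\mu}+\lambda f'(z)\Big(\frac{f(z)}{z}\Big)^{\mu-1}\prec\varphi(z)\quad(z\in\mathbb U)$$ and $$(1-\lambda)\Big(\frac{g(w)}{w}\Big)^{\mu}+\lambda g'(w)\Big(\frac{g(w)}{w}\Big)^{\mu-1}\prec\varphi(w)\quad(w\in\mathbb U),$$ where $g=f^{-1}$ and all powers are principal branches taking the value $1$ at the origin. *)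

theory Defs
  imports "HOL-Analysis.Analysis"
begin

abbreviation unit_disk :: "complex set" where
  "unit_disk \<equiv> ball 0 1"

definition taylor_coeff :: "(complex \<Rightarrow> complex) \<Rightarrow> nat \<Rightarrow> complex" where
  "taylor_coeff f n = (deriv ^^ n) f 0 / of_nat (fact n)"

definition class_A :: "(complex \<Rightarrow> complex) \<Rightarrow> bool" where
  "class_A f \<longleftrightarrow> f holomorphic_on unit_disk \<and> f 0 = 0 \<and> deriv f 0 = 1"

definition inverse_extension :: "(complex \<Rightarrow> complex) \<Rightarrow> (complex \<Rightarrow> complex) \<Rightarrow> bool" where
  "inverse_extension f g \<longleftrightarrow> g holomorphic_on unit_disk \<and> inj_on g unit_disk \<and>
     (\<exists>e>0. \<forall>w\<in>ball 0 e. g w \<in> unit_disk \<and> f (g w) = w)"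

definition bi_univalent :: "(complex \<Rightarrow> complex) \<Rightarrow> bool" where
  "bi_univalent f \<longleftrightarrow> class_A f \<and> inj_on f unit_disk \<and> (\<exists>g. inverse_extension f g)"

definition subordinate :: "(complex \<Rightarrow> complex) \<Rightarrow> (complex \<Rightarrow> complex) \<Rightarrow> bool" where
  "subordinate F G \<longleftrightarrow> (\<exists>w. w holomorphic_on unit_disk \<and> w ` unit_disk \<subseteq> unit_disk \<and> w 0 = 0 \<and>
      (\<forall>z\<in>unit_disk. F z = G (w z)))"

text \<open>The Bazilevic-type condition
  (1-\<lambda>)(h(z)/z)^\<mu> + \<lambda> h'(z) (h(z)/z)^(\<mu>-1) \<prec> \<phi>,
  where the powers are the branches analytic in U with value 1 at 0:
  (h(z)/z)^c = exp(c L(z)) with L analytic, L(0)=0 and exp(L(z)) = h(z)/z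
  (h(z)/z being understood as h'(0)=1 at z=0).\<close>
definition bazilevic_subord ::
  "real \<Rightarrow> real \<Rightarrow> (complex \<Rightarrow> complex) \<Rightarrow> (complex \<Rightarrow> complex) \<Rightarrow> bool" where
  "bazilevic_subord mu lam \<phi> h \<longleftrightarrow>
     (\<exists>L. L holomorphic_on unit_disk \<and> L 0 = 0 \<and>
        (\<forall>z\<in>unit_disk. exp (L z) = (if z = 0 then 1 else h z / z)) \<and>
        subordinate
          (\<lambda>z. (1 - of_real lam) * exp (of_real mu * L z)
               + of_real lam * deriv h z * exp (of_real (mu - 1) * L z)) \<phi>)"

definition class_N :: "real \<Rightarrow> real \<Rightarrow> (complex \<Rightarrow> complex) \<Rightarrow> (complex \<Rightarrow> complex) \<Rightarrow> bool" where
  "class_N mu lam \<phi> f \<longleftrightarrow> bi_univalent f \<and> bazilevic_subord mu lam \<phi> f \<and>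
     (\<exists>g. inverse_extension f g \<and> bazilevic_subord mu lam \<phi> g)"

definition admissible_phi :: "(complex \<Rightarrow> complex) \<Rightarrow> bool" where
  "admissible_phi \<phi> \<longleftrightarrow> \<phi> holomorphic_on unit_disk \<and> inj_on \<phi> unit_disk \<and>
     (\<forall>z\<in>unit_disk. Re (\<phi> z) > 0) \<and> \<phi> 0 = 1 \<and>
     deriv \<phi> 0 \<in> \<real> \<and> Re (deriv \<phi> 0) > 0 \<and>
     (\<forall>v\<in>\<phi> ` unit_disk. \<forall>t\<in>{0..1::real}. 1 + of_real t * (v - 1) \<in> \<phi> ` unit_disk) \<and>
     (\<forall>v\<in>\<phi> ` unit_disk. cnj v \<in> \<phi> ` unit_disk) \<and>
     (\<forall>n. taylor_coeff \<phi> n \<in> \<real>)"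

end

theory Submission
  imports Defs "HOL-Complex_Analysis.Complex_Analysis"
begin

text \<open>
  Write the two subordinations as \<open>F = \<phi> \<circ> u\<close> and \<open>G = \<phi> \<circ> v\<close> with Schwarz functions \<open>u, v\<close>.
  Comparing coefficients of order one gives \<open>v\<^sub>1 = -u\<^sub>1\<close>. With \<open>s = u\<^sub>2 + u\<^sub>1\<^sup>2\<close> and \<open>t = v\<^sub>2 + v\<^sub>1\<^sup>2\<close>,
  both of modulus at most \<open>1\<close> by the Schwarz-Pick bound \<open>|u\<^sub>2| \<le> 1 - |u\<^sub>1|\<^sup>2\<close>, the coefficients
  of order two give \<open>D a\<^sub>2\<^sup>2 = B\<^sub>1\<^sup>3 (s + t)\<close> and \<open>2 (2\<lambda> + \<mu>) (a\<^sub>3 - a\<^sub>2\<^sup>2) = B\<^sub>1 (s - t)\<close>. Hence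
  \<open>a\<^sub>3 - \<delta> a\<^sub>2\<^sup>2 = h (s + t) + k (s - t)\<close> with real \<open>h = (1 - \<delta>) B\<^sub>1\<^sup>3 / D\<close> and
  \<open>k = B\<^sub>1 / (2 (2\<lambda> + \<mu>))\<close>, whose modulus is at most \<open>|h + k| + |h - k| = 2 max |h| |k|\<close>.
\<close>

section \<open>Power series at the origin and low-order coefficients of compositions\<close>

lemma taylor_coeff_fps:
  assumes "f has_fps_expansion F"
  shows "taylor_coeff f n = fps_nth F n"
  using fps_nth_fps_expansion[OF assms] by (simp add: taylor_coeff_def)

lemma has_fps_expansion_taylor:
  assumes "f holomorphic_on unit_disk"
  shows "f has_fps_expansion Abs_fps (taylor_coeff f)"
proof -
  have "f has_fps_expansion fps_expansion f 0"
    using assms by (intro has_fps_expansion_fps_expansion[of unit_disk]) auto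
  moreover from this have "fps_expansion f 0 = Abs_fps (taylor_coeff f)"
    by (simp add: fps_eq_iff taylor_coeff_fps)
  ultimately show ?thesis by simp
qed

lemma has_fps_expansion_cong_disk:
  fixes f g :: "complex \<Rightarrow> complex"
  assumes "f has_fps_expansion F" "0 < e" "\<And>z. z \<in> ball 0 e \<Longrightarrow> g z = f z"
  shows "g has_fps_expansion F"
proof -
  have "eventually (\<lambda>z. z \<in> ball 0 e) (nhds (0::complex))"
    using assms(2) by (intro eventually_nhds_in_open) auto
  then have "eventually (\<lambda>z. g z = f z) (nhds 0)"
    using assms(3) by (rule eventually_mono)
  then show ?thesis
    using assms(1) has_fps_expansion_cong[of g f F F] by simp
qed

lemma fps_compose_nth_1:
  assumes "fps_nth G 0 = 0"
  shows "fps_nth (fps_compose F G) 1 = fps_nth F 1 * fps_nth G 1"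
  using assms by (simp add: fps_compose_nth)

lemma fps_compose_nth_2:
  assumes "fps_nth G 0 = (0::complex)"
  shows "fps_nth (fps_compose F G) 2 = fps_nth F 1 * fps_nth G 2 + fps_nth F 2 * (fps_nth G 1)\<^sup>2"
  using assms
  by (simp add: fps_compose_nth fps_mult_nth numeral_2_eq_2)

lemma fps_compose_nth_3:
  assumes "fps_nth G 0 = (0::complex)"
  shows "fps_nth (fps_compose F G) 3 = fps_nth F 1 * fps_nth G 3
    + 2 * fps_nth F 2 * fps_nth G 1 * fps_nth G 2 + fps_nth F 3 * (fps_nth G 1) ^ 3"
  using assms
  by (simp add: fps_compose_nth fps_mult_nth numeral_2_eq_2 numeral_3_eq_3)

section \<open>Coefficient bounds for Schwarz functions\<close>

lemma schwarz_pick_origin: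
  assumes hol: "h holomorphic_on unit_disk" and lt: "\<And>z. cmod z < 1 \<Longrightarrow> cmod (h z) < 1"
  shows "cmod (deriv h 0) \<le> 1 - (cmod (h 0))\<^sup>2"
proof -
  \<comment> \<open>\<open>M\<close> is the disk automorphism sending \<open>h 0\<close> to 0, so
    \<open>M \<circ> h\<close> satisfies Schwarz's lemma. By the chain rule its derivative at 0 is
    \<open>deriv h 0\<close> divided by \<open>1 - (cmod (h 0))\<^sup>2\<close>.\<close>
  define M where "M = Moebius_function 0 (h 0)"
  have h0: "cmod (h 0) < 1" using lt[of 0] by simp
  have holM: "M holomorphic_on unit_disk"
    unfolding M_def by (rule Moebius_function_holomorphic[OF h0])
  have "deriv (M \<circ> h) 0 = deriv M (h 0) * deriv h 0"
    using hol holM h0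
    by (intro deriv_chain) (auto intro!: holomorphic_on_imp_differentiable_at[of _ unit_disk])
  moreover have "cmod (deriv (M \<circ> h) 0) \<le> 1"
  proof (rule Schwarz_Lemma(2)[of _ 0])
    show "M \<circ> h holomorphic_on unit_disk"
      using hol holM lt by (intro holomorphic_on_compose_gen[of _ _ _ unit_disk]) auto
  qed (use lt h0 in \<open>auto simp: M_def Moebius_function_eq_zero Moebius_function_norm_lt_1\<close>)
  moreover have "deriv M (h 0) = 1 / of_real (1 - (cmod (h 0))\<^sup>2)"
  proof (rule DERIV_imp_deriv)
    have sq: "(cmod (h 0))\<^sup>2 < 1"
      using h0 by (simp add: abs_square_less_1)
    have e: "cnj (h 0) * h 0 = of_real ((cmod (h 0))\<^sup>2)"
      by (metis complex_norm_square mult.commute)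
    have "complex_of_real ((cmod (h 0))\<^sup>2) \<noteq> of_real 1"
      unfolding of_real_eq_iff using sq by simp
    then have nz: "1 - cnj (h 0) * h 0 \<noteq> 0"
      unfolding e by simp
    have "((\<lambda>z. (z - h 0) / (1 - cnj (h 0) * z)) has_field_derivative
        1 / (1 - cnj (h 0) * h 0)) (at (h 0))"
      by (rule derivative_eq_intros refl | use nz in \<open>simp; fail\<close>)+
    then show "(M has_field_derivative 1 / of_real (1 - (cmod (h 0))\<^sup>2)) (at (h 0))"
      unfolding e by (simp add: M_def Moebius_function_simple[abs_def])
  qed
  ultimately have "cmod (1 / of_real (1 - (cmod (h 0))\<^sup>2) * deriv h 0) \<le> 1"
    by simp
  then have "cmod (deriv h 0) / \<bar>1 - (cmod (h 0))\<^sup>2\<bar> \<le> 1"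
    unfolding norm_mult norm_divide norm_of_real by simp
  moreover have "0 < 1 - (cmod (h 0))\<^sup>2"
    using h0 by (simp add: abs_square_less_1)
  ultimately show ?thesis
    by simp
qed

text \<open>Dividing out the zero, u(z) = z h(z), turns the first two coefficients of
  \<open>u\<close> into \<open>h 0\<close> and \<open>deriv h 0\<close>, so Schwarz-Pick for
  \<open>h\<close> at the origin gives the bound. This requires \<open>h\<close> to map strictly
  into the disk, which fails exactly when \<open>u\<close> is a rotation; then the second
  coefficient is 0 and the first has modulus 1.\<close>

lemma schwarz_second_coeff:
  assumes hol: "u holomorphic_on unit_disk" and im: "u ` unit_disk \<subseteq> unit_disk" and u0: "u 0 = 0"
  shows "cmod (taylor_coeff u 2) \<le> 1 - (cmod (taylor_coeff u 1))\<^sup>2"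
proof -
  have lt: "cmod (u z) < 1" if "cmod z < 1" for z
    using subsetD[OF im imageI[of z unit_disk u]] that by simp
  obtain h where holh: "h holomorphic_on unit_disk"
    and uh: "\<And>z. cmod z < 1 \<Longrightarrow> u z = z * h z"
    using Schwarz3[OF hol u0] by metis
  have "(\<lambda>z. z * h z) has_fps_expansion fps_X * Abs_fps (taylor_coeff h)"
    by (intro fps_expansion_intros has_fps_expansion_taylor holh)
  then have "u has_fps_expansion fps_X * Abs_fps (taylor_coeff h)"
    by (rule has_fps_expansion_cong_disk[of _ _ 1]) (auto simp: uh)
  then have c: "taylor_coeff u 1 = h 0" "taylor_coeff u 2 = deriv h 0"
    by (auto simp: taylor_coeff_fps) (simp_all add: taylor_coeff_def)
  have le: "cmod (h z) \<le> 1" if "z \<noteq> 0" "cmod z < 1" for z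
    using Schwarz_Lemma(1)[OF hol u0 lt that(2)] uh[OF that(2)] that by (simp add: norm_mult)
  show ?thesis
  proof (cases "\<exists>\<alpha>. (\<forall>z. cmod z < 1 \<longrightarrow> u z = \<alpha> * z) \<and> cmod \<alpha> = 1")
    case True
    then obtain \<alpha> where \<alpha>: "\<And>z. cmod z < 1 \<Longrightarrow> u z = \<alpha> * z" "cmod \<alpha> = 1"
      by blast
    have "(\<lambda>z. \<alpha> * z) has_fps_expansion fps_const \<alpha> * fps_X"
      by (intro fps_expansion_intros)
    then have "u has_fps_expansion fps_const \<alpha> * fps_X"
      by (rule has_fps_expansion_cong_disk[of _ _ 1]) (auto simp: \<alpha>(1))
    then show ?thesis
      by (simp add: taylor_coeff_fps \<alpha>(2))
  next
    case False
    have d: "deriv u 0 = h 0"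
      using c(1) by (simp add: taylor_coeff_def)
    \<comment> \<open>A point with |h(z)| = 1 is an equality case of Schwarz's lemma: |u(z)| = |z|
      if z is nonzero, |u'(0)| = 1 if z = 0. Either one makes \<open>u\<close> a rotation.\<close>
    have "cmod (h z) < 1" if z: "cmod z < 1" for z
    proof (rule ccontr)
      assume n: "\<not> cmod (h z) < 1"
      have "cmod (deriv u 0) \<le> 1"
        by (rule Schwarz_Lemma(2)[OF hol u0 lt, of 0]) auto
      then have "(\<exists>z. cmod z < 1 \<and> z \<noteq> 0 \<and> cmod (u z) = cmod z) \<or> cmod (deriv u 0) = 1"
        using n z le[of z] uh[OF z] d
        by (cases "z = 0") (auto simp: norm_mult intro!: exI[of _ z])
      with False show False
        using Schwarz_Lemma(3)[OF hol u0 lt, of 0] by auto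
    qed
    from schwarz_pick_origin[OF holh this] show ?thesis
      unfolding c .
  qed
qed

lemma schwarz_coeff_bound:
  assumes "u holomorphic_on unit_disk" "u ` unit_disk \<subseteq> unit_disk" "u 0 = 0"
  shows "cmod (taylor_coeff u 2 + (taylor_coeff u 1)\<^sup>2) \<le> 1"
  using schwarz_second_coeff[OF assms]
    norm_triangle_ineq[of "taylor_coeff u 2" "(taylor_coeff u 1)\<^sup>2"]
  by (simp add: norm_power)

section \<open>Coefficient equations from the subordinations and from inversion\<close>

lemma subordinate_coeffs:
  assumes "subordinate F \<phi>" "\<phi> holomorphic_on unit_disk"
  obtains p q where "cmod (q + p\<^sup>2) \<le> 1"
    and "taylor_coeff F 1 = taylor_coeff \<phi> 1 * p"
    and "taylor_coeff F 2 = taylor_coeff \<phi> 1 * q + taylor_coeff \<phi> 2 * p\<^sup>2"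
proof -
  obtain u where u: "u holomorphic_on unit_disk" "u ` unit_disk \<subseteq> unit_disk" "u 0 = 0"
    and eq: "\<forall>z\<in>unit_disk. F z = \<phi> (u z)"
    using assms(1) unfolding subordinate_def by blast
  define P U where "P = Abs_fps (taylor_coeff \<phi>)" and "U = Abs_fps (taylor_coeff u)"
  have U0: "fps_nth U 0 = 0"
    using u(3) by (simp add: U_def taylor_coeff_def)
  have "(\<phi> \<circ> u) has_fps_expansion fps_compose P U"
    unfolding P_def U_def using U0
    by (intro has_fps_expansion_compose has_fps_expansion_taylor u assms) (simp add: U_def)
  then have "F has_fps_expansion fps_compose P U"
    by (rule has_fps_expansion_cong_disk[of _ _ 1]) (use eq in auto)
  \<comment> \<open>The witnesses for \<open>p\<close> and \<open>q\<close> are the first and second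
    coefficients of the Schwarz function \<open>u\<close>.\<close>
  then have "taylor_coeff F 1 = taylor_coeff \<phi> 1 * taylor_coeff u 1"
    and "taylor_coeff F 2 = taylor_coeff \<phi> 1 * taylor_coeff u 2
           + taylor_coeff \<phi> 2 * (taylor_coeff u 1)\<^sup>2"
    unfolding taylor_coeff_fps[OF \<open>F has_fps_expansion _\<close>] fps_compose_nth_1[OF U0]
      fps_compose_nth_2[OF U0] by (simp_all add: P_def U_def)
  with schwarz_coeff_bound[OF u] show thesis
    by (rule that)
qed

text \<open>With h(z)/z = exp(L(z)), both \<open>h\<close> and the powers of h(z)/z are exponentials
  of multiples of \<open>L\<close>, up to a factor z. Hence the coefficients of \<open>h\<close> and
  of the subordinate function are polynomials in the first two coefficients of \<open>L\<close>,
  which can be eliminated.\<close>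

lemma bazilevic_coeffs:
  fixes mu lam :: real
  assumes baz: "bazilevic_subord mu lam \<phi> h" and h0: "h 0 = 0"
    and phi: "\<phi> holomorphic_on unit_disk"
  obtains p q where "cmod (q + p\<^sup>2) \<le> 1"
    and "of_real (lam + mu) * taylor_coeff h 2 = taylor_coeff \<phi> 1 * p"
    and "of_real (2 * lam + mu) * (taylor_coeff h 3 + of_real ((mu - 1) / 2) * (taylor_coeff h 2)\<^sup>2)
           = taylor_coeff \<phi> 1 * q + taylor_coeff \<phi> 2 * p\<^sup>2"
    and "taylor_coeff h 1 = 1" and "h has_fps_expansion Abs_fps (taylor_coeff h)"
proof -
  obtain L where L: "L holomorphic_on unit_disk" "L 0 = 0"
    and expL: "\<forall>z\<in>unit_disk. exp (L z) = (if z = 0 then 1 else h z / z)"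
    and sub: "subordinate
          (\<lambda>z. (1 - of_real lam) * exp (of_real mu * L z)
               + of_real lam * deriv h z * exp (of_real (mu - 1) * L z)) \<phi>"
    using baz unfolding bazilevic_subord_def by blast
  define l where "l = Abs_fps (taylor_coeff L)"
  \<comment> \<open>\<open>E c\<close> is the expansion of the power (h(z)/z)^c.\<close>
  define E where "E c = fps_compose (fps_exp c) l" for c :: complex
  have l0: "fps_nth l 0 = 0"
    using L(2) by (simp add: l_def taylor_coeff_def)
  have E: "(\<lambda>z. exp (c * L z)) has_fps_expansion E c" for c
    using has_fps_expansion_compose[OF has_fps_expansion_exp[of c]
        has_fps_expansion_taylor[OF L(1)]] l0
    by (simp add: E_def l_def o_def)
  have E_nth: "fps_nth (E c) 0 = 1" "fps_nth (E c) 1 = c * fps_nth l 1"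
    "fps_nth (E c) 2 = c * fps_nth l 2 + c\<^sup>2 / 2 * (fps_nth l 1)\<^sup>2" for c
    unfolding E_def fps_compose_nth_1[OF l0] fps_compose_nth_2[OF l0] by simp_all
  have "(\<lambda>z. z * exp (1 * L z)) has_fps_expansion fps_X * E 1"
    by (intro fps_expansion_intros E)
  \<comment> \<open>The condition on \<open>exp (L z)\<close> leaves the value of \<open>h\<close>
    at 0 open; \<open>h0\<close> supplies it.\<close>
  then have H: "h has_fps_expansion fps_X * E 1"
    by (rule has_fps_expansion_cong_disk[of _ _ 1]) (use expL h0 in auto)
  have h_nth: "taylor_coeff h 1 = 1" "taylor_coeff h 2 = fps_nth l 1"
    "taylor_coeff h 3 = fps_nth l 2 + (fps_nth l 1)\<^sup>2 / 2"
    unfolding taylor_coeff_fps[OF H] using E_nth[of 1] by (simp_all add: numeral_2_eq_2 numeral_3_eq_3)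
  define F where "F = fps_const (1 - of_real lam) * E (of_real mu)
      + fps_const (of_real lam) * fps_deriv (fps_X * E 1) * E (of_real (mu - 1))"
  have "(\<lambda>z. (1 - of_real lam) * exp (of_real mu * L z)
      + of_real lam * deriv h z * exp (of_real (mu - 1) * L z)) has_fps_expansion F"
    unfolding F_def by (intro fps_expansion_intros E H)
  note Fn = taylor_coeff_fps[OF this]
  obtain p q where pq: "cmod (q + p\<^sup>2) \<le> 1" "fps_nth F 1 = taylor_coeff \<phi> 1 * p"
    "fps_nth F 2 = taylor_coeff \<phi> 1 * q + taylor_coeff \<phi> 2 * p\<^sup>2"
    by (rule subordinate_coeffs[OF sub phi, unfolded Fn])
  have D_nth: "fps_nth (fps_deriv (fps_X * E 1)) 0 = 1"
    "fps_nth (fps_deriv (fps_X * E 1)) 1 = 2 * fps_nth (E 1) 1"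
    "fps_nth (fps_deriv (fps_X * E 1)) 2 = 3 * fps_nth (E 1) 2"
    using E_nth(1)[of 1] by (simp_all add: numeral_2_eq_2)
  have m1: "fps_nth (A * B) 1 = fps_nth A 0 * fps_nth B 1 + fps_nth A 1 * fps_nth B 0"
    and m2: "fps_nth (A * B) 2 = fps_nth A 0 * fps_nth B 2 + fps_nth A 1 * fps_nth B 1
      + fps_nth A 2 * fps_nth B 0" for A B :: "complex fps"
    by (simp_all add: fps_mult_nth numeral_2_eq_2)
  have F1: "fps_nth F 1 = of_real (lam + mu) * taylor_coeff h 2"
    unfolding F_def fps_add_nth mult.assoc fps_mult_left_const_nth m1 D_nth E_nth h_nth
    by (simp add: algebra_simps)
  have F2: "fps_nth F 2 = of_real (2 * lam + mu) *
      (taylor_coeff h 3 + of_real ((mu - 1) / 2) * (taylor_coeff h 2)\<^sup>2)"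
    unfolding F_def fps_add_nth mult.assoc fps_mult_left_const_nth m2 D_nth E_nth h_nth
    by (simp add: field_simps power2_eq_square)
  have "h has_fps_expansion Abs_fps (taylor_coeff h)"
    unfolding taylor_coeff_fps[OF H, abs_def] fps_nth_inverse by (rule H)
  then show thesis
    using pq h_nth(1) unfolding F1 F2 by (intro that) auto
qed

text \<open>Near 0 the composition of \<open>f\<close> with \<open>g\<close> is the identity, so its
  coefficients of orders 2 and 3 vanish; these two equations are solved successively.\<close>

lemma inverse_coeffs:
  assumes f: "f has_fps_expansion Abs_fps (taylor_coeff f)" "taylor_coeff f 1 = 1"
    and g: "g has_fps_expansion Abs_fps (taylor_coeff g)" "taylor_coeff g 1 = 1" "g 0 = 0"
    and inv: "0 < e" "\<And>w. w \<in> ball 0 e \<Longrightarrow> f (g w) = w"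
  shows "taylor_coeff g 2 = - taylor_coeff f 2"
    and "taylor_coeff g 3 = 2 * (taylor_coeff f 2)\<^sup>2 - taylor_coeff f 3"
proof -
  define A B where "A = Abs_fps (taylor_coeff f)" and "B = Abs_fps (taylor_coeff g)"
  have B0: "fps_nth B 0 = 0"
    using g(3) by (simp add: B_def taylor_coeff_def)
  have "(f \<circ> g) has_fps_expansion fps_compose A B"
    using f(1) g(1) B0 unfolding A_def B_def by (rule has_fps_expansion_compose)
  moreover have "(f \<circ> g) has_fps_expansion fps_X"
    by (rule has_fps_expansion_cong_disk[OF has_fps_expansion_fps_X inv(1)]) (use inv(2) in auto)
  ultimately have X: "fps_compose A B = fps_X"
    by (rule fps_expansion_unique_complex)
  have "fps_nth (fps_compose A B) 2 = 0" "fps_nth (fps_compose A B) 3 = 0"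
    unfolding X by simp_all
  then have e: "taylor_coeff g 2 + taylor_coeff f 2 = 0"
    "taylor_coeff g 3 + 2 * taylor_coeff f 2 * taylor_coeff g 2 + taylor_coeff f 3 = 0"
    unfolding fps_compose_nth_2[OF B0] fps_compose_nth_3[OF B0]
    using f(2) g(2) by (simp_all add: A_def B_def)
  from e(1) show b2: "taylor_coeff g 2 = - taylor_coeff f 2"
    by (simp add: add_eq_0_iff2)
  show "taylor_coeff g 3 = 2 * (taylor_coeff f 2)\<^sup>2 - taylor_coeff f 3"
    using e(2) unfolding b2 by (simp add: power2_eq_square) algebra
qed

section \<open>The final estimate\<close>

lemma norm_real_combination_le:
  fixes s t :: complex and h k :: real
  assumes "cmod s \<le> 1" "cmod t \<le> 1"
  shows "cmod (of_real h * (s + t) + of_real k * (s - t)) \<le> 2 * max \<bar>h\<bar> \<bar>k\<bar>"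
proof -
  \<comment> \<open>Regrouping by \<open>s\<close> and \<open>t\<close> before the triangle
    inequality gives a maximum; estimating s + t and s - t separately would only give 2|h| +
    2|k|.\<close>
  have "of_real h * (s + t) + of_real k * (s - t) = of_real (h + k) * s + of_real (h - k) * t"
    by (simp add: algebra_simps)
  also have "cmod \<dots> \<le> cmod (of_real (h + k) * s) + cmod (of_real (h - k) * t)"
    by (rule norm_triangle_ineq)
  also have "\<dots> = \<bar>h + k\<bar> * cmod s + \<bar>h - k\<bar> * cmod t"
    unfolding norm_mult norm_of_real by simp
  also have "\<dots> \<le> \<bar>h + k\<bar> + \<bar>h - k\<bar>"
    using assms by (intro add_mono mult_left_le) auto
  also have "\<dots> = 2 * max \<bar>h\<bar> \<bar>k\<bar>"
    by auto
  finally show ?thesis .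
qed

theorem theorem2p1:
  fixes lam mu dlt :: real and \<phi> f :: "complex \<Rightarrow> complex"
  assumes "lam \<ge> 1" and "mu \<ge> 0"
    and "admissible_phi \<phi>"
    and "class_N mu lam \<phi> f"
  defines "B1 \<equiv> Re (taylor_coeff \<phi> 1)"
    and "B2 \<equiv> Re (taylor_coeff \<phi> 2)"
    and "a2 \<equiv> taylor_coeff f 2"
    and "a3 \<equiv> taylor_coeff f 3"
  defines "D \<equiv> (2*lam + mu) * (1 + mu) * B1^2 + 2 * (B1 - B2) * (lam + mu)^2"
  assumes "D \<noteq> 0"
  shows "(\<bar>dlt - 1\<bar> \<le> (mu + 1) / 2 *
            \<bar>1 + 2 * (B1 - B2) * (lam + mu)^2 / (B1^2 * (2*lam + mu) * (1 + mu))\<bar>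
          \<longrightarrow> cmod (a3 - of_real dlt * a2^2) \<le> B1 / (2*lam + mu))
       \<and> (\<bar>dlt - 1\<bar> \<ge> (mu + 1) / 2 *
            \<bar>1 + 2 * (B1 - B2) * (lam + mu)^2 / (B1^2 * (2*lam + mu) * (1 + mu))\<bar>
          \<longrightarrow> cmod (a3 - of_real dlt * a2^2) \<le> 2 * B1^3 * \<bar>dlt - 1\<bar> / \<bar>D\<bar>)"
proof -
  have phi: "\<phi> holomorphic_on unit_disk" and real: "\<And>n. taylor_coeff \<phi> n \<in> \<real>"
    and B1_pos: "B1 > 0"
    using assms(3) by (auto simp: admissible_phi_def B1_def taylor_coeff_def)
  have B: "taylor_coeff \<phi> 1 = of_real B1" "taylor_coeff \<phi> 2 = of_real B2"
    using real by (simp_all add: B1_def B2_def)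
  obtain g e where bf: "bazilevic_subord mu lam \<phi> f" and bg: "bazilevic_subord mu lam \<phi> g"
    and f0: "f 0 = 0" and injf: "inj_on f unit_disk" and e: "e > 0"
    and inv: "\<And>w. w \<in> ball 0 e \<Longrightarrow> g w \<in> unit_disk \<and> f (g w) = w"
    using assms(4) unfolding class_N_def bi_univalent_def class_A_def inverse_extension_def by metis
  \<comment> \<open>Both \<open>g 0\<close> and 0 lie in the disk and are sent to 0 by the injective
    \<open>f\<close>.\<close>
  have g0: "g 0 = 0"
    using inv[of 0] e f0 inj_onD[OF injf, of "g 0" 0] by auto
  obtain p q where pq: "cmod (q + p\<^sup>2) \<le> 1"
    and f1: "of_real (lam + mu) * a2 = of_real B1 * p"
    and f2: "of_real (2 * lam + mu) * (a3 + of_real ((mu - 1) / 2) * a2\<^sup>2)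
           = of_real B1 * q + of_real B2 * p\<^sup>2"
    and f: "taylor_coeff f 1 = 1" "f has_fps_expansion Abs_fps (taylor_coeff f)"
    using bazilevic_coeffs[OF bf f0 phi, folded a2_def a3_def, unfolded B] by metis
  obtain p' q' where pq': "cmod (q' + p'\<^sup>2) \<le> 1"
    and g1: "of_real (lam + mu) * taylor_coeff g 2 = of_real B1 * p'"
    and g2: "of_real (2 * lam + mu) * (taylor_coeff g 3 + of_real ((mu - 1) / 2) * (taylor_coeff g 2)\<^sup>2)
           = of_real B1 * q' + of_real B2 * p'\<^sup>2"
    and g: "taylor_coeff g 1 = 1" "g has_fps_expansion Abs_fps (taylor_coeff g)"
    using bazilevic_coeffs[OF bg g0 phi, unfolded B] by metis
  have b: "taylor_coeff g 2 = - a2" "taylor_coeff g 3 = 2 * a2\<^sup>2 - a3"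
    using inverse_coeffs[OF f(2,1) g(2,1) g0 e] inv by (auto simp: a2_def a3_def)
  define s t where "s = q + p\<^sup>2" and "t = q' + p'\<^sup>2"
  define N :: real where "N = 2 * lam + mu"
  have N: "N > 0" using assms(1,2) by (simp add: N_def)
  \<comment> \<open>The first-order equations force p' = -p, so the same square of \<open>p\<close>
    enters both second-order equations.\<close>
  have "of_real B1 * p' = of_real B1 * (- p)"
    using f1 g1 b(1) by simp
  then have p': "p' = - p"
    using B1_pos by (simp only: mult_cancel_left of_real_eq_0_iff) auto
  \<comment> \<open>\<open>q\<close> is replaced by \<open>s\<close>, the quantity with a bound, at
    the cost of the term with B1 - B2.\<close>
  have eq1: "of_real N * (a3 + of_real ((mu - 1) / 2) * a2\<^sup>2)
      = of_real B1 * s - of_real (B1 - B2) * p\<^sup>2"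
    using f2 by (simp add: N_def s_def algebra_simps)
  have eq2: "of_real N * (2 * a2\<^sup>2 - a3 + of_real ((mu - 1) / 2) * a2\<^sup>2)
      = of_real B1 * t - of_real (B1 - B2) * p\<^sup>2"
    using g2 unfolding b p' by (simp add: N_def t_def p' algebra_simps)
  \<comment> \<open>Subtracting \<open>eq1\<close> and \<open>eq2\<close> cancels the square of
    \<open>p\<close>; adding them cancels \<open>a3\<close>.\<close>
  have diff: "of_real (2 * N) * (a3 - a2\<^sup>2) = of_real B1 * (s - t)"
    using arg_cong2[OF eq1 eq2, of "(-)"] by (simp add: algebra_simps)
  have sum: "of_real (N * (1 + mu)) * a2\<^sup>2 = of_real B1 * (s + t) - 2 * of_real (B1 - B2) * p\<^sup>2"
  proof -
    have "of_real (N * (1 + mu)) * a2\<^sup>2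
        = of_real N * (a3 + of_real ((mu - 1) / 2) * a2\<^sup>2)
        + of_real N * (2 * a2\<^sup>2 - a3 + of_real ((mu - 1) / 2) * a2\<^sup>2)"
      by (simp add: field_simps)
    then show ?thesis
      unfolding eq1 eq2 by (simp add: algebra_simps)
  qed
  have sq: "of_real ((lam + mu)\<^sup>2) * a2\<^sup>2 = of_real (B1\<^sup>2) * p\<^sup>2"
    using arg_cong[OF f1, of "\<lambda>x. x\<^sup>2"] by (simp add: power_mult_distrib)
  \<comment> \<open>\<open>D\<close> arises here: \<open>sum\<close> is multiplied by the square of
    \<open>B1\<close>, and \<open>sq\<close> trades the remaining square of \<open>p\<close> for
    that of \<open>a2\<close>.\<close>
  have "of_real D * a2\<^sup>2 = of_real (B1\<^sup>2) * (of_real (N * (1 + mu)) * a2\<^sup>2)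
      + 2 * of_real (B1 - B2) * (of_real ((lam + mu)\<^sup>2) * a2\<^sup>2)"
    by (simp add: D_def N_def algebra_simps)
  also have "\<dots> = of_real (B1 ^ 3) * (s + t)"
    unfolding sum sq by (simp add: algebra_simps power2_eq_square power3_eq_cube)
  finally have a2: "a2\<^sup>2 = of_real (B1 ^ 3 / D) * (s + t)"
    using assms(10) by (simp add: field_simps)
  have a3: "a3 - a2\<^sup>2 = of_real (B1 / (2 * N)) * (s - t)"
    using diff N by (simp add: field_simps)
  define h k where "h = (1 - dlt) * (B1 ^ 3 / D)" and "k = B1 / (2 * N)"
  have "a3 - of_real dlt * a2\<^sup>2 = (a3 - a2\<^sup>2) + of_real (1 - dlt) * a2\<^sup>2"
    by (simp add: algebra_simps)
  also have "\<dots> = of_real h * (s + t) + of_real k * (s - t)"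
    unfolding a3 unfolding a2 h_def k_def of_real_mult by (simp add: algebra_simps)
  finally have main: "cmod (a3 - of_real dlt * a2\<^sup>2) \<le> 2 * max \<bar>h\<bar> \<bar>k\<bar>"
    using norm_real_combination_le[of s t h k] pq pq' by (simp add: s_def t_def)
  have k: "2 * \<bar>k\<bar> = B1 / (2 * lam + mu)"
    using N B1_pos by (simp add: k_def flip: N_def)
  have h: "2 * \<bar>h\<bar> = 2 * B1 ^ 3 * \<bar>dlt - 1\<bar> / \<bar>D\<bar>"
    using B1_pos by (simp add: h_def abs_mult abs_minus_commute)
  have "B1\<^sup>2 * N * (1 + mu) \<noteq> 0"
    using B1_pos N assms(2) by simp
  then have "1 + 2 * (B1 - B2) * (lam + mu)^2 / (B1^2 * N * (1 + mu)) = D / (B1\<^sup>2 * N * (1 + mu))"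
    unfolding D_def N_def[symmetric] by (simp add: add_divide_distrib ac_simps)
  then have "(mu + 1) / 2 * \<bar>1 + 2 * (B1 - B2) * (lam + mu)^2 / (B1^2 * (2*lam + mu) * (1 + mu))\<bar>
      = (mu + 1) / 2 * \<bar>D / (B1\<^sup>2 * N * (1 + mu))\<bar>"
    unfolding N_def by (rule arg_cong)
  also have "\<dots> = \<bar>D\<bar> / (2 * B1\<^sup>2 * N)"
    using B1_pos N assms(2) by (simp add: abs_mult add.commute)
  finally have thr: "(mu + 1) / 2 *
      \<bar>1 + 2 * (B1 - B2) * (lam + mu)^2 / (B1^2 * (2*lam + mu) * (1 + mu))\<bar> = \<bar>D\<bar> / (2 * B1\<^sup>2 * N)" .
  \<comment> \<open>Pulling out the common positive factor \<open>B1 ^ 3 / \<bar>D\<bar>\<close>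
    turns the comparison of |h| with |k| into that of |dlt - 1| with the threshold, so each case of
    the theorem selects one argument of the maximum.\<close>
  have "\<bar>h\<bar> = \<bar>dlt - 1\<bar> * (B1 ^ 3 / \<bar>D\<bar>)" "\<bar>k\<bar> = \<bar>D\<bar> / (2 * B1\<^sup>2 * N) * (B1 ^ 3 / \<bar>D\<bar>)"
    using N B1_pos assms(10)
    by (simp_all add: h_def k_def abs_mult abs_minus_commute power2_eq_square power3_eq_cube)
  moreover have "B1 ^ 3 / \<bar>D\<bar> > 0"
    using B1_pos assms(10) by simp
  ultimately have "\<bar>h\<bar> \<le> \<bar>k\<bar> \<longleftrightarrow> \<bar>dlt - 1\<bar> \<le> \<bar>D\<bar> / (2 * B1\<^sup>2 * N)"
    and "\<bar>k\<bar> \<le> \<bar>h\<bar> \<longleftrightarrow> \<bar>D\<bar> / (2 * B1\<^sup>2 * N) \<le> \<bar>dlt - 1\<bar>"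
    by (simp_all only: mult_le_cancel_right_pos)
  with main show ?thesis
    unfolding thr using h k by auto
qed

end
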